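(* Let $v$ be a self-similar weak solution of $u_t+f(u)_x=0$ and let $\xi_\star\in\mathbb R$ be an ess-im discontinuity point for $v$. Then there exist $u^-\in\mathcal A^-(v;\xi_\star)$ and $u^+\in\mathcal A^+(v;\xi_\star)$ with $u^+\ne u^-$, i.e., $(u^-,\xi_\star,u^+)$ is an R-H jump. Moreover, the matrix $M(u^-,\xi_\star,u^+)$ is singular: $$\det M(u^-,\xi_\star,u^+)=0.$$
   Context: Let $n\ge 1$, let $\mathbb U\subseteq\mathbb R^n$ be open, let $f:\mathbb U\to\mathbb R^n$ be $C^2$, and $A:=Df$. $\mathbb U_{SH}\subseteq\mathbb U$ is the set of states $u$ at which $A(u)$ has $n$ real, distinct eigenvalues. It is assumed that the convex hull of $\mathbb U_{SH}$ is contained in $\mathbb U$. For $u^-,u^+\in\mathbb U_{SH}$ and $\xi\in\mathbb R$, $\overline A(u^-,u^+):=\int_0^1A((1-\tau)u^-+\tau u^+)\,d\tau$ and $M(u^-,\xi,u^+):=-\xi I+\overline A(u^-,u^+)$. An R-H jump is a triple $(u^-,s,u^+)$ with $u^+\ne u^-$ and $-s(u^+-u^-)+f(u^+)-f(u^-)=0$. For $v\in L^\infty(\mathbb R;\mathbb R^n)$ and measurable $J\subseteq\mathbb R$, $\operatorname{ess\,im} v|_J$ is the set of $u\in\mathbb R^n$ such that $v^{-1}[U]\cap J$ has positive Lebesgue measure for every neighborhood $U$ of $u$; $\operatorname{ess\,im}v:=\operatorname{ess\,im}v|_{\mathbb R}$. The left and right ess-im accumulation sets are $\mathcal A^-(v;\xi):=\bigcap_{r>0}\operatorname{ess\,im}v|_{(\xi-r,\xi)}$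 and $\mathcal A^+(v;\xi):=\bigcap_{r>0}\operatorname{ess\,im}v|_{(\xi,\xi+r)}$. The point $\xi$ is an ess-im continuity point for $v$ if $\mathcal A^-(v;\xi)$ and $\mathcal A^+(v;\xi)$ are the same singleton; otherwise it is an ess-im discontinuity point. A self-similar weak solution is a function $v\in L^\infty(\mathbb R;\mathbb R^n)$ with $\operatorname{ess\,im}v\subseteq\mathbb U_{SH}$ such that $\int_{-\infty}^\infty\{\frac{d\psi}{d\xi}\cdot[-\xi v+f(v)]-\psi\cdot v\}\,d\xi=0$ for all $\psi\in C^1_c(\mathbb R;\mathbb R^n)$. *)

theory Defs
  imports "HOL-Analysis.Analysis"
begin

definition C2_on :: "'a::euclidean_space set \<Rightarrow> ('a \<Rightarrow> 'b::euclidean_space) \<Rightarrow> bool" where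
  "C2_on S f \<longleftrightarrow>
     (\<exists>(f' :: 'a \<Rightarrow> 'a \<Rightarrow>\<^sub>L 'b) (f'' :: 'a \<Rightarrow> 'a \<Rightarrow>\<^sub>L ('a \<Rightarrow>\<^sub>L 'b)).
        (\<forall>x\<in>S. (f has_derivative blinfun_apply (f' x)) (at x)) \<and>
        (\<forall>x\<in>S. (f' has_derivative blinfun_apply (f'' x)) (at x)) \<and>
        continuous_on S f'')"

definition real_eigenvalues :: "real^'n^'n \<Rightarrow> real set" where
  "real_eigenvalues B = {l. \<exists>x. x \<noteq> 0 \<and> B *v x = l *\<^sub>R x}"

definition U_SH :: "(real^'n) set \<Rightarrow> (real^'n \<Rightarrow> real^'n) \<Rightarrow> (real^'n) set" where
  "U_SH U f = {u \<in> U. card (real_eigenvalues (jacobian f (at u))) = CARD('n)}"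

definition A_bar :: "(real^'n \<Rightarrow> real^'n) \<Rightarrow> real^'n \<Rightarrow> real^'n \<Rightarrow> real^'n^'n" where
  "A_bar f um up = integral {0..1} (\<lambda>\<tau>. jacobian f (at ((1 - \<tau>) *\<^sub>R um + \<tau> *\<^sub>R up)))"

definition M_mat :: "(real^'n \<Rightarrow> real^'n) \<Rightarrow> real^'n \<Rightarrow> real \<Rightarrow> real^'n \<Rightarrow> real^'n^'n" where
  "M_mat f um \<xi> up = - (\<xi> *\<^sub>R mat 1) + A_bar f um up"

definition RH_jump ::
    "(real^'n) set \<Rightarrow> (real^'n \<Rightarrow> real^'n) \<Rightarrow> real^'n \<Rightarrow> real \<Rightarrow> real^'n \<Rightarrow> bool" where
  "RH_jump U f um s up \<longleftrightarrow>
     um \<in> U \<and> up \<in> U \<and> up \<noteq> um \<and> - (s *\<^sub>R (up - um)) + f up - f um = 0"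

definition L_infty :: "(real \<Rightarrow> real^'n) \<Rightarrow> bool" where
  "L_infty v \<longleftrightarrow>
     v \<in> borel_measurable lebesgue \<and> (\<exists>C. AE \<xi> in lebesgue. norm (v \<xi>) \<le> C)"

(* It suffices to test open neighbourhoods N. They are used because the preimage of an
   arbitrary neighbourhood need not be measurable, and emeasure is 0 on non-measurable sets. *)
definition ess_im :: "(real \<Rightarrow> real^'n) \<Rightarrow> real set \<Rightarrow> (real^'n) set" where
  "ess_im v J = {u. \<forall>N. open N \<and> u \<in> N \<longrightarrow> emeasure lebesgue (v -` N \<inter> J) > 0}"

definition acc_left :: "(real \<Rightarrow> real^'n) \<Rightarrow> real \<Rightarrow> (real^'n) set" where
  "acc_left v \<xi> = (\<Inter>r\<in>{0<..}. ess_im v {\<xi> - r<..<\<xi>})"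

definition acc_right :: "(real \<Rightarrow> real^'n) \<Rightarrow> real \<Rightarrow> (real^'n) set" where
  "acc_right v \<xi> = (\<Inter>r\<in>{0<..}. ess_im v {\<xi><..<\<xi> + r})"

definition ess_im_continuity_point :: "(real \<Rightarrow> real^'n) \<Rightarrow> real \<Rightarrow> bool" where
  "ess_im_continuity_point v \<xi> \<longleftrightarrow> (\<exists>u. acc_left v \<xi> = {u} \<and> acc_right v \<xi> = {u})"

abbreviation ess_im_discontinuity_point :: "(real \<Rightarrow> real^'n) \<Rightarrow> real \<Rightarrow> bool" where
  "ess_im_discontinuity_point v \<xi> \<equiv> \<not> ess_im_continuity_point v \<xi>"

definition C1_compact_support :: "(real \<Rightarrow> real^'n) \<Rightarrow> bool" where
  "C1_compact_support \<psi> \<longleftrightarrow>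
     \<psi> C1_differentiable_on UNIV \<and> compact (closure {\<xi>. \<psi> \<xi> \<noteq> 0})"

(* f is only meaningful on U. Since v takes values in its essential image almost everywhere,
   the values of f outside U enter the integrand only on a null set, and the completeness of
   the lebesgue measure makes them irrelevant. As the essential image is a compact subset
   of U, the integrand is automatically integrable when f is continuous on U, so
   has_bochner_integral demands no more than that the integral vanishes. *)
definition self_similar_weak_solution ::
    "(real^'n) set \<Rightarrow> (real^'n \<Rightarrow> real^'n) \<Rightarrow> (real \<Rightarrow> real^'n) \<Rightarrow> bool" where
  "self_similar_weak_solution U f v \<longleftrightarrow>
     L_infty v \<and> ess_im v UNIV \<subseteq> U_SH U f \<and>
     (\<forall>\<psi>. C1_compact_support \<psi> \<longrightarrow>
        has_bochner_integral lebesgue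
          (\<lambda>\<xi>. vector_derivative \<psi> (at \<xi>) \<bullet> (- (\<xi> *\<^sub>R v \<xi>) + f (v \<xi>)) - \<psi> \<xi> \<bullet> v \<xi>) 0)"

end

theory Submission
  imports Defs
begin

text \<open>
  The flux \<open>h(x) = - x v(x) + f(v(x))\<close> has the bounded weak derivative \<open>- v\<close>. Suppose that \<open>h\<close> is
  close to \<open>p\<close> on sets of positive measure arbitrarily near \<open>\<xi>\<close> on the left and close to \<open>q\<close> on such
  sets on the right. Choose continuous probability densities \<open>\<phi>\<close> and \<open>\<theta>\<close>, supported within \<open>r\<close> of
  \<open>\<xi>\<close> on the left and on the right, which nearly are normalised indicators of compact subsets of these
  sets. The antiderivative of \<open>\<phi> - \<theta>\<close> is a test function bounded by 2 and supported in an interval of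
  length \<open>2 r\<close>, so \<open>p - q\<close> is \<open>O(r)\<close> up to a small error, and \<open>p = q\<close>. Hence every pair of a left
  and a right accumulation value satisfies the Rankine-Hugoniot condition. The accumulation
  sets are nonempty by compactness, so at a discontinuity point some pair is distinct; its difference
  is in the kernel of \<open>M\<close> by the fundamental theorem of calculus along the segment.
\<close>

section \<open>Test functions and weak derivatives on the line\<close>

definition supported_in :: "real \<Rightarrow> real \<Rightarrow> (real \<Rightarrow> real) \<Rightarrow> bool" where
  "supported_in a b \<phi> \<longleftrightarrow> continuous_on UNIV \<phi> \<and> (\<forall>x. x \<notin> {a<..<b} \<longrightarrow> \<phi> x = 0)"

text \<open>Encodes \<open>h' = w\<close> in the sense of distributions, with the derivative
  \<open>\<phi>\<close> of the test function as an explicit parameter, so that it can be prescribed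
  first. Integrability is asked of the combined integrand; that of \<open>\<phi> * h\<close> alone
  is derived below from a bound on \<open>w\<close>.\<close>

definition has_weak_derivative :: "(real \<Rightarrow> real) \<Rightarrow> (real \<Rightarrow> real) \<Rightarrow> bool" where
  "has_weak_derivative h w \<longleftrightarrow>
     (\<forall>\<psi> \<phi> a b. (\<forall>x. (\<psi> has_real_derivative \<phi> x) (at x)) \<and> continuous_on UNIV \<phi> \<and>
        (\<forall>x. x \<notin> {a..b} \<longrightarrow> \<psi> x = 0) \<longrightarrow>
        has_bochner_integral lebesgue (\<lambda>x. \<phi> x * h x + \<psi> x * w x) 0)"

text \<open>Bridge between the Bochner integral over the line and the Henstock-Kurzweil integral
  over \<open>{a..b}\<close>, for which the fundamental theorem of calculus is available.\<close>

lemma supported_in_has_bochner_integral: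
  assumes "supported_in a b \<phi>"
  shows "has_bochner_integral lebesgue \<phi> (integral {a..b} \<phi>)"
proof -
  have "set_integrable lebesgue {a..b} \<phi>"
    using assms unfolding supported_in_def
    by (intro absolutely_integrable_continuous_real) (auto intro: continuous_on_subset)
  moreover have "(\<lambda>x. indicator {a..b} x *\<^sub>R \<phi> x) = \<phi>"
  proof
    show "indicator {a..b} x *\<^sub>R \<phi> x = \<phi> x" for x
      using assms by (cases "x \<in> {a<..<b}") (auto simp: supported_in_def)
  qed
  ultimately show ?thesis
    using set_lebesgue_integral_eq_integral[of "{a..b}" \<phi>]
    by (simp add: set_integrable_def set_lebesgue_integral_def has_bochner_integral_iff)
qed

lemma supported_in_integrable: "supported_in a b \<phi> \<Longrightarrow> integrable lebesgue \<phi>"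
  using supported_in_has_bochner_integral has_bochner_integral_iff by blast

lemma supported_in_abs: "supported_in a b \<phi> \<Longrightarrow> supported_in a b (\<lambda>x. \<bar>\<phi> x\<bar>)"
  by (auto simp: supported_in_def intro: continuous_on_rabs)

lemma continuous_antiderivative:
  fixes \<phi> :: "real \<Rightarrow> real"
  assumes "continuous_on UNIV \<phi>"
  obtains F where "\<And>x. (F has_real_derivative \<phi> x) (at x)"
proof -
  have "\<exists>F. \<forall>x::real. - \<infinity> < ereal x \<longrightarrow> ereal x < \<infinity> \<longrightarrow> (F has_vector_derivative \<phi> x) (at x)"
    using assms by (intro einterval_antiderivative) (auto simp: continuous_on_eq_continuous_at)
  then show ?thesis
    using that by (auto simp: has_real_derivative_iff_has_vector_derivative)
qed

text \<open>Any antiderivative \<open>F\<close> is constant to the left of \<open>a\<close> and to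
  the right of \<open>b\<close>. Mean zero makes the two constants equal, so \<open>F - F a\<close>
  vanishes outside the interval; inside, it is an integral of \<open>\<phi>\<close> starting at
  \<open>a\<close>, hence at most the L1 norm.\<close>

lemma supported_antiderivative:
  assumes \<phi>: "supported_in a b \<phi>" and "a \<le> b" and mean: "integral\<^sup>L lebesgue \<phi> = 0"
  obtains \<psi> where "\<And>x. (\<psi> has_real_derivative \<phi> x) (at x)"
    and "\<And>x. x \<notin> {a..b} \<Longrightarrow> \<psi> x = 0" and "\<And>x. \<bar>\<psi> x\<bar> \<le> (LINT x|lebesgue. \<bar>\<phi> x\<bar>)"
proof -
  have cont: "continuous_on A \<phi>" for A
    using \<phi> by (auto simp: supported_in_def intro: continuous_on_subset)
  obtain F where F: "\<And>x. (F has_real_derivative \<phi> x) (at x)"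
    using continuous_antiderivative cont by blast
  have int: "(\<phi> has_integral F y - F x) {x..y}" if "x \<le> y" for x y
    using that F
    by (intro fundamental_theorem_of_calculus)
       (auto simp: has_real_derivative_iff_has_vector_derivative intro: has_vector_derivative_at_within)
  have left: "F x = F a" if "x \<le> a" for x
  proof -
    have "(\<phi> has_integral 0) {x..a}"
      using \<phi> by (intro has_integral_is_0) (auto simp: supported_in_def)
    then show ?thesis
      using has_integral_unique[OF int[OF that]] by fastforce
  qed
  have "F b = F a"
    using int[OF \<open>a \<le> b\<close>] supported_in_has_bochner_integral[OF \<phi>] mean
    by (simp add: has_bochner_integral_iff integral_unique)
  have right: "F x = F a" if "b \<le> x" for x
  proof -
    have "(\<phi> has_integral 0) {b..x}"
      using \<phi> by (intro has_integral_is_0) (auto simp: supported_in_def)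
    then show ?thesis
      using has_integral_unique[OF int[OF that]] \<open>F b = F a\<close> by fastforce
  qed
  have abs_int: "(LINT x|lebesgue. \<bar>\<phi> x\<bar>) = integral {a..b} (\<lambda>x. \<bar>\<phi> x\<bar>)"
    using supported_in_has_bochner_integral[OF supported_in_abs[OF \<phi>]]
    by (simp add: has_bochner_integral_iff)
  have io: "(\<lambda>x. \<bar>\<phi> x\<bar>) integrable_on {x..y}" for x y
    by (intro integrable_continuous_real continuous_intros cont)
  have mid: "\<bar>F x - F a\<bar> \<le> (LINT x|lebesgue. \<bar>\<phi> x\<bar>)" if "x \<in> {a..b}" for x
  proof -
    have "\<bar>F x - F a\<bar> = norm (integral {a..x} \<phi>)"
      using int[of a x] that by (simp add: integral_unique)
    also have "\<dots> \<le> integral {a..x} (\<lambda>x. \<bar>\<phi> x\<bar>)"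
      by (rule integral_norm_bound_integral) (auto intro: io integrable_continuous_real cont)
    also have "\<dots> \<le> integral {a..b} (\<lambda>x. \<bar>\<phi> x\<bar>)"
      using that by (intro integral_subset_le io) auto
    finally show ?thesis by (simp add: abs_int)
  qed
  have nn: "0 \<le> (LINT x|lebesgue. \<bar>\<phi> x\<bar>)" by simp
  show ?thesis
  proof (rule that[of "\<lambda>x. F x - F a"])
    show "((\<lambda>x. F x - F a) has_real_derivative \<phi> x) (at x)" for x
      using F by (auto intro!: derivative_eq_intros)
    show "F x - F a = 0" if "x \<notin> {a..b}" for x
      using that left[of x] right[of x] by force
    show "\<bar>F x - F a\<bar> \<le> (LINT x|lebesgue. \<bar>\<phi> x\<bar>)" for x
      using left[of x] right[of x] mid[of x] nn by (cases "x \<in> {a..b}") auto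
  qed
qed

section \<open>Integrals against functions with a bounded weak derivative\<close>

text \<open>The antiderivative \<open>\<psi>\<close> of \<open>\<phi>\<close> is an admissible test
  function, so the integral of \<open>\<phi> * h\<close> is minus that of \<open>\<psi> * w\<close>,
  where \<open>\<psi>\<close> is at most the L1 norm of \<open>\<phi>\<close> and lives on an
  interval of length \<open>b - a\<close>. As \<open>\<psi> * w\<close> is essentially bounded with
  bounded support, subtracting it from the combined integrand leaves \<open>\<phi> * h\<close>
  integrable.\<close>

lemma weak_derivative_bound:
  assumes h: "has_weak_derivative h w"
    and w: "w \<in> borel_measurable lebesgue" "AE x in lebesgue. \<bar>w x\<bar> \<le> C"
    and \<phi>: "supported_in a b \<phi>" "integral\<^sup>L lebesgue \<phi> = 0" and "a \<le> b"
  shows "integrable lebesgue (\<lambda>x. \<phi> x * h x)"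
    and "\<bar>LINT x|lebesgue. \<phi> x * h x\<bar> \<le> (b - a) * C * (LINT x|lebesgue. \<bar>\<phi> x\<bar>)"
proof -
  let ?N = "LINT x|lebesgue. \<bar>\<phi> x\<bar>"
  obtain \<psi> where \<psi>: "\<And>x. (\<psi> has_real_derivative \<phi> x) (at x)"
    "\<And>x. x \<notin> {a..b} \<Longrightarrow> \<psi> x = 0" "\<And>x. \<bar>\<psi> x\<bar> \<le> ?N"
    using supported_antiderivative \<phi> \<open>a \<le> b\<close> by blast
  have hb: "has_bochner_integral lebesgue (\<lambda>x. \<phi> x * h x + \<psi> x * w x) 0"
    using h \<psi> \<phi> unfolding has_weak_derivative_def supported_in_def by blast
  have "continuous_on UNIV \<psi>"
    using \<psi>(1) DERIV_isCont by (auto simp: continuous_on_eq_continuous_at)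
  then have "\<psi> \<in> borel_measurable lebesgue"
    by (intro measurable_completion) (auto intro: borel_measurable_continuous_onI)
  then have [measurable]: "(\<lambda>x. \<psi> x * w x) \<in> borel_measurable lebesgue"
    using w(1) by measurable
  have bd_int: "integrable lebesgue (\<lambda>x. (?N * C) * indicator {a..b} x)"
    by (intro integrable_mult_right) (auto intro: integrable_real_indicator simp: emeasure_lborel_Icc_eq)
  have bd: "AE x in lebesgue. norm (\<psi> x * w x) \<le> (?N * C) * indicator {a..b} x"
    using w(2)
  proof eventually_elim
    case (elim x)
    show ?case
    proof (cases "x \<in> {a..b}")
      case True
      then show ?thesis
        using elim \<psi>(3)[of x] by (auto simp: abs_mult intro!: mult_mono)
    qed (use \<psi>(2) in auto)
  qed
  have int\<psi>: "integrable lebesgue (\<lambda>x. \<psi> x * w x)"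
    by (rule Bochner_Integration.integrable_bound[OF bd_int]) (use bd in \<open>auto elim!: eventually_mono\<close>)
  have hb2: "has_bochner_integral lebesgue (\<lambda>x. (\<phi> x * h x + \<psi> x * w x) - \<psi> x * w x)
      (0 - (LINT x|lebesgue. \<psi> x * w x))"
    by (intro has_bochner_integral_diff hb has_bochner_integral_integrable int\<psi>)
  then show "integrable lebesgue (\<lambda>x. \<phi> x * h x)"
    by (simp add: has_bochner_integral_iff)
  have "\<bar>LINT x|lebesgue. \<phi> x * h x\<bar> = \<bar>LINT x|lebesgue. \<psi> x * w x\<bar>"
    using hb2 by (simp add: has_bochner_integral_iff)
  also have "\<dots> \<le> (LINT x|lebesgue. \<bar>\<psi> x * w x\<bar>)"
    by (rule integral_abs_bound)
  also have "\<dots> \<le> (LINT x|lebesgue. (?N * C) * indicator {a..b} x)"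
    using bd by (intro integral_mono_AE bd_int integrable_abs int\<psi>) auto
  also have "\<dots> = (b - a) * C * ?N"
    using \<open>a \<le> b\<close> by simp
  finally show "\<bar>LINT x|lebesgue. \<phi> x * h x\<bar> \<le> (b - a) * C * ?N" .
qed

text \<open>Subtracting from \<open>\<phi>\<close> its translate by the length of the interval gives a function of mean
  zero, the derivative of an admissible test function, which agrees with \<open>\<phi>\<close> on \<open>{a<..<b}\<close>.\<close>

lemma weak_derivative_integrable:
  assumes h: "has_weak_derivative h w"
    and w: "w \<in> borel_measurable lebesgue" "AE x in lebesgue. \<bar>w x\<bar> \<le> C"
    and \<phi>: "supported_in a b \<phi>" and "a \<le> b"
  shows "integrable lebesgue (\<lambda>x. \<phi> x * h x)"
proof -
  let ?c = "b - a"
  have "continuous_on UNIV (\<lambda>x. \<phi> (x - ?c))"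
    using \<phi> unfolding supported_in_def
    by (intro continuous_on_compose2[of UNIV \<phi> UNIV "\<lambda>x. x - ?c"] continuous_intros) auto
  then have shift: "supported_in b (b + ?c) (\<lambda>x. \<phi> (x - ?c))"
    using \<phi> by (auto simp: supported_in_def)
  then have supp: "supported_in a (b + ?c) (\<lambda>x. \<phi> x - \<phi> (x - ?c))"
    using \<phi> \<open>a \<le> b\<close> by (auto simp: supported_in_def intro: continuous_on_diff)
  note s2 = supported_in_has_bochner_integral[OF shift]
  have "(\<phi> has_integral integral {a..b} \<phi>) (cbox a b)"
    using \<phi> unfolding supported_in_def box_real
    by (intro integrable_integral integrable_continuous_real) (auto intro: continuous_on_subset)
  \<comment> \<open>Translation invariance of the integral: the affine change of variables with
    factor 1 and shift \<open>a - b\<close>.\<close>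
  from has_integral_affinity[OF this, of 1 "- ?c"] image_add_atLeastAtMost'[of ?c a b]
  have "((\<lambda>x. \<phi> (x - ?c)) has_integral integral {a..b} \<phi>) {b..b + ?c}"
    by (simp add: algebra_simps)
  then have "integral\<^sup>L lebesgue (\<lambda>x. \<phi> x - \<phi> (x - ?c)) = 0"
    using s2 supported_in_has_bochner_integral[OF \<phi>]
    by (simp add: has_bochner_integral_iff integral_unique)
  then have "integrable lebesgue (\<lambda>x. (\<phi> x - \<phi> (x - ?c)) * h x)"
    using weak_derivative_bound(1)[OF h w supp] \<open>a \<le> b\<close> by simp
  from integrable_mult_indicator[OF _ this, of "{a<..<b}"]
  have "integrable lebesgue (\<lambda>x. indicator {a<..<b} x *\<^sub>R ((\<phi> x - \<phi> (x - ?c)) * h x))"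
    by simp
  also have "(\<lambda>x. indicator {a<..<b} x *\<^sub>R ((\<phi> x - \<phi> (x - ?c)) * h x)) = (\<lambda>x. \<phi> x * h x)"
    using \<phi> by (auto simp: supported_in_def indicator_def fun_eq_iff)
  finally show ?thesis .
qed

section \<open>Densities concentrated where the function is near a given value\<close>

text \<open>On a compact \<open>T\<close> inside \<open>S\<close> of positive measure, the mean of
  \<open>h\<close> is within \<open>\<epsilon>\<close> of \<open>p\<close>. Continuous cutoffs
  converge pointwise to the indicator of \<open>T\<close>, so by dominated convergence their
  normalised weighted means of \<open>h\<close> converge to that mean.\<close>

lemma weighted_density_near_value:
  assumes int: "\<And>\<phi>. supported_in a b \<phi> \<Longrightarrow> integrable lebesgue (\<lambda>x. \<phi> x * h x)"
    and S: "S \<in> sets lebesgue" "S \<subseteq> {a<..<b}" "emeasure lebesgue S > 0"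
    and near: "\<And>x. x \<in> S \<Longrightarrow> \<bar>h x - p\<bar> < \<epsilon>" and "\<epsilon> > 0"
  obtains \<phi> where "supported_in a b \<phi>" "\<And>x. 0 \<le> \<phi> x" "integral\<^sup>L lebesgue \<phi> = 1"
    "\<bar>(LINT x|lebesgue. \<phi> x * h x) - p\<bar> < 2 * \<epsilon>"
proof -
  have "bounded S"
    using S(2) by (metis bounded_subset bounded_box box_real(1))
  then have "S \<in> lmeasurable"
    using S by (intro bounded_set_imp_lmeasurable) auto
  then have "emeasure lebesgue S = measure lebesgue S"
    by (rule emeasure_eq_measure2)
  moreover from this S have "measure lebesgue S > 0"
    by simp
  \<comment> \<open>The error allowed in inner regularity is the measure of \<open>S\<close> itself,
    so that \<open>T\<close> cannot be a null set.\<close>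
  ultimately obtain T where T: "closed T" "T \<subseteq> S" "emeasure lebesgue (S - T) < emeasure lebesgue S"
    using sets_lebesgue_inner_closed[OF S(1)] by metis
  have T_sets [measurable]: "T \<in> sets lebesgue"
    using T(1) by auto
  have "compact T"
    using T \<open>bounded S\<close> by (meson bounded_subset compact_eq_bounded_closed)
  have "T \<in> lmeasurable"
    using \<open>compact T\<close> by (rule lmeasurable_compact)
  have "emeasure lebesgue T \<noteq> 0"
  proof
    assume "emeasure lebesgue T = 0"
    then have "emeasure lebesgue (S - T) = emeasure lebesgue S"
      using S(1) T_sets by (intro emeasure_Diff_null_set) auto
    then show False using T(3) by simp
  qed
  define m where "m = measure lebesgue T"
  have m: "m > 0"
    using \<open>emeasure lebesgue T \<noteq> 0\<close> emeasure_eq_measure2[OF \<open>T \<in> lmeasurable\<close>] zero_less_measure_iff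
    by (auto simp: m_def)
  \<comment> \<open>The distance \<open>infdist\<close> to the empty set is 0 by convention, so the
    separation arguments below need a point in \<open>T\<close>.\<close>
  have "T \<noteq> {}"
    using m by (auto simp: m_def)
  then obtain \<delta> where \<delta>: "\<delta> > 0" "{x. infdist x T \<le> \<delta>} \<subseteq> {a<..<b}"
    using compact_in_open_separated[OF _ \<open>compact T\<close>, of "{a<..<b}"] T S(2) by auto
  \<comment> \<open>The factor \<open>Suc n\<close> rather than \<open>n\<close> makes already
    \<open>\<phi> 0\<close> vanish beyond distance \<open>\<delta>\<close> from \<open>T\<close>. It
    then confines all the cutoffs to \<open>{a<..<b}\<close> and serves as their dominating
    weight.\<close>
  define \<phi> where "\<phi> n x = max 0 (1 - real (Suc n) * (infdist x T / \<delta>))" for n x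
  have \<phi>01: "0 \<le> \<phi> n x" for n x
    by (simp add: \<phi>_def)
  have \<phi>T: "\<phi> n x = 1" if "x \<in> T" for n x
    using that by (simp add: \<phi>_def)
  have \<phi>_le: "\<phi> n x \<le> \<phi> 0 x" for n x
  proof -
    have "1 * (infdist x T / \<delta>) \<le> real (Suc n) * (infdist x T / \<delta>)"
      using \<delta>(1) infdist_nonneg[of x T] by (intro mult_right_mono) auto
    then show ?thesis by (simp add: \<phi>_def)
  qed
  have supp: "supported_in a b (\<phi> n)" for n
    unfolding supported_in_def
  proof (intro conjI allI impI)
    show "continuous_on UNIV (\<phi> n)"
      unfolding \<phi>_def by (intro continuous_intros) (use \<delta>(1) in auto)
    fix x assume "x \<notin> {a<..<b}"
    then have "infdist x T > \<delta>" using \<delta>(2) by force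
    then have "\<phi> 0 x = 0" using \<delta>(1) by (simp add: \<phi>_def)
    then show "\<phi> n x = 0" using \<phi>_le[of n x] \<phi>01[of n x] by linarith
  qed
  have lim: "(\<lambda>n. \<phi> n x) \<longlonglongrightarrow> indicator T x" for x
  proof (cases "x \<in> T")
    case False
    then have "infdist x T / \<delta> > 0"
      using \<delta>(1) infdist_pos_not_in_closed[OF T(1) \<open>T \<noteq> {}\<close>] by simp
    then obtain N where N: "1 < real N * (infdist x T / \<delta>)"
      using ex_less_of_nat_mult by blast
    have "\<phi> n x = 0" if "n \<ge> N" for n
    proof -
      have "real N * (infdist x T / \<delta>) \<le> real (Suc n) * (infdist x T / \<delta>)"
        using that \<open>infdist x T / \<delta> > 0\<close> by (intro mult_right_mono) auto
      then show ?thesis using N by (simp add: \<phi>_def)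
    qed
    then show ?thesis
      using False by (intro tendsto_eventually) (auto simp: eventually_sequentially)
  qed (simp add: \<phi>T)
  \<comment> \<open>Integrability on \<open>T\<close>, and with it measurability, is inherited from
    \<open>\<phi> 0 * g\<close>, since \<open>\<phi> 0\<close> equals 1 on \<open>T\<close>.\<close>
  have restrict: "integrable lebesgue (\<lambda>x. indicator T x * g x)"
    if "integrable lebesgue (\<lambda>x. \<phi> 0 x * g x)" for g :: "real \<Rightarrow> real"
  proof -
    have "integrable lebesgue (\<lambda>x. indicator T x * (\<phi> 0 x * g x))"
      using integrable_mult_indicator[OF T_sets that] by simp
    also have "(\<lambda>x. indicator T x * (\<phi> 0 x * g x)) = (\<lambda>x. indicator T x * g x)"
      using \<phi>T by (auto simp: indicator_def fun_eq_iff)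
    finally show ?thesis .
  qed
  have conv: "(\<lambda>n. LINT x|lebesgue. \<phi> n x * g x) \<longlonglongrightarrow> (LINT x|lebesgue. indicator T x * g x)"
    if "\<And>n. integrable lebesgue (\<lambda>x. \<phi> n x * g x)" for g :: "real \<Rightarrow> real"
  proof (rule integral_dominated_convergence[where w = "\<lambda>x. \<bar>\<phi> 0 x * g x\<bar>"])
    show "(\<lambda>x. indicator T x * g x) \<in> borel_measurable lebesgue"
      using restrict that by blast
    show "AE x in lebesgue. norm (\<phi> n x * g x) \<le> \<bar>\<phi> 0 x * g x\<bar>" for n
      using \<phi>_le \<phi>01 by (auto simp: abs_mult intro!: mult_right_mono)
  qed (use that in \<open>auto intro!: tendsto_mult lim\<close>)
  define M where "M n = integral\<^sup>L lebesgue (\<phi> n)" for n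
  define I where "I = (LINT x|lebesgue. indicator T x * h x)"
  have M_lim: "M \<longlonglongrightarrow> m"
    using conv[of "\<lambda>_. 1"] supported_in_integrable[OF supp] by (simp add: M_def[abs_def] m_def)
  have I_lim: "(\<lambda>n. LINT x|lebesgue. \<phi> n x * h x) \<longlonglongrightarrow> I"
    unfolding I_def by (intro conv int supp)
  have intT: "integrable lebesgue (\<lambda>x. indicator T x * h x)" "integrable lebesgue (indicat_real T)"
    using restrict int supp \<open>T \<in> lmeasurable\<close> by (auto simp: fmeasurable_def)
  have "I - p * m = (LINT x|lebesgue. indicator T x * h x - p * indicator T x)"
    using intT by (simp add: I_def m_def)
  also have "\<bar>\<dots>\<bar> \<le> (LINT x|lebesgue. \<bar>indicator T x * h x - p * indicator T x\<bar>)"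
    by (rule integral_abs_bound)
  also have "\<dots> \<le> (LINT x|lebesgue. \<epsilon> * indicator T x)"
  proof (intro integral_mono integrable_abs)
    show "integrable lebesgue (\<lambda>x. indicator T x * h x - p * indicator T x)"
      "integrable lebesgue (\<lambda>x. \<epsilon> * indicator T x)"
      using intT by (auto intro: Bochner_Integration.integrable_diff integrable_mult_right)
    show "\<bar>indicator T x * h x - p * indicator T x\<bar> \<le> \<epsilon> * indicator T x" for x
      using near[of x] T(2) by (cases "x \<in> T") auto
  qed
  also have "\<dots> = \<epsilon> * m"
    using intT by (simp add: m_def)
  finally have "\<bar>I - p * m\<bar> \<le> \<epsilon> * m" .
  then have "\<bar>I / m - p\<bar> \<le> \<epsilon>"
    using m by (simp add: field_simps abs_le_iff)
  moreover have "(\<lambda>n. \<bar>(LINT x|lebesgue. \<phi> n x * h x) / M n - p\<bar>) \<longlonglongrightarrow> \<bar>I / m - p\<bar>"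
    using m by (intro tendsto_intros I_lim M_lim) auto
  \<comment> \<open>The limit is at most \<open>\<epsilon>\<close>; the gap up to
    \<open>2 * \<epsilon>\<close> gives the strict inequality for all large
    \<open>n\<close>.\<close>
  ultimately have "\<forall>\<^sub>F n in sequentially. \<bar>(LINT x|lebesgue. \<phi> n x * h x) / M n - p\<bar> < 2 * \<epsilon>"
    using \<open>\<epsilon> > 0\<close> by (intro order_tendstoD(2)) auto
  moreover have "\<forall>\<^sub>F n in sequentially. M n > 0"
    using M_lim m by (rule order_tendstoD(1))
  ultimately obtain n where n: "\<bar>(LINT x|lebesgue. \<phi> n x * h x) / M n - p\<bar> < 2 * \<epsilon>" "M n > 0"
    using eventually_happens'[OF sequentially_bot eventually_conj] by blast
  show ?thesis
  proof (rule that[of "\<lambda>x. \<phi> n x / M n"])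
    show "supported_in a b (\<lambda>x. \<phi> n x / M n)"
      using supp[of n] n(2) by (auto simp: supported_in_def intro!: continuous_on_divide)
    show "0 \<le> \<phi> n x / M n" for x
      using n(2) \<phi>01 by simp
    show "(LINT x|lebesgue. \<phi> n x / M n) = 1"
      using n(2) by (simp add: M_def)
    show "\<bar>(LINT x|lebesgue. \<phi> n x / M n * h x) - p\<bar> < 2 * \<epsilon>"
      using n(1) by simp
  qed
qed

section \<open>Equality of one-sided values\<close>

lemma weak_derivative_no_jump:
  assumes h: "has_weak_derivative h w"
    and w: "w \<in> borel_measurable lebesgue" "AE x in lebesgue. \<bar>w x\<bar> \<le> C"
    and left: "\<And>r \<epsilon>. 0 < r \<Longrightarrow> 0 < \<epsilon> \<Longrightarrow> \<exists>S\<in>sets lebesgue. S \<subseteq> {\<xi> - r<..<\<xi>} \<and>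
      emeasure lebesgue S > 0 \<and> (\<forall>x\<in>S. \<bar>h x - p\<bar> < \<epsilon>)"
    and right: "\<And>r \<epsilon>. 0 < r \<Longrightarrow> 0 < \<epsilon> \<Longrightarrow> \<exists>S\<in>sets lebesgue. S \<subseteq> {\<xi><..<\<xi> + r} \<and>
      emeasure lebesgue S > 0 \<and> (\<forall>x\<in>S. \<bar>h x - q\<bar> < \<epsilon>)"
  shows "p = q"
proof -
  \<comment> \<open>A nonnegative bound is wanted, because it is multiplied below with an upper
    bound for an L1 norm.\<close>
  have w': "AE x in lebesgue. \<bar>w x\<bar> \<le> \<bar>C\<bar>"
    using w(2) by eventually_elim auto
  \<comment> \<open>With tolerance \<open>r\<close> for both densities, each weighted mean misses
    its value by less than \<open>2 * r\<close>, which gives \<open>4 * r\<close>. The weak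
    derivative contributes interval length \<open>2 * r\<close> times \<open>\<bar>C\<bar>\<close>
    times the L1 norm of the difference, which is at most 2.\<close>
  have close: "\<bar>p - q\<bar> \<le> r * (4 + 4 * \<bar>C\<bar>)" if r: "r > 0" for r
  proof -
    have int: "integrable lebesgue (\<lambda>x. \<phi> x * h x)" if "supported_in a b \<phi>" "a \<le> b" for \<phi> a b
      using weak_derivative_integrable[OF h w] that by blast
    obtain \<phi> where \<phi>: "supported_in (\<xi> - r) \<xi> \<phi>" "\<And>x. 0 \<le> \<phi> x" "integral\<^sup>L lebesgue \<phi> = 1"
      "\<bar>(LINT x|lebesgue. \<phi> x * h x) - p\<bar> < 2 * r"
    proof -
      obtain S where S: "S \<in> sets lebesgue" "S \<subseteq> {\<xi> - r<..<\<xi>}" "emeasure lebesgue S > 0"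
        "\<And>x. x \<in> S \<Longrightarrow> \<bar>h x - p\<bar> < r"
        using left[OF r r] by blast
      show ?thesis
        by (rule weighted_density_near_value[OF _ S r]) (use int r that in auto)
    qed
    obtain \<theta> where \<theta>: "supported_in \<xi> (\<xi> + r) \<theta>" "\<And>x. 0 \<le> \<theta> x" "integral\<^sup>L lebesgue \<theta> = 1"
      "\<bar>(LINT x|lebesgue. \<theta> x * h x) - q\<bar> < 2 * r"
    proof -
      obtain S where S: "S \<in> sets lebesgue" "S \<subseteq> {\<xi><..<\<xi> + r}" "emeasure lebesgue S > 0"
        "\<And>x. x \<in> S \<Longrightarrow> \<bar>h x - q\<bar> < r"
        using right[OF r r] by blast
      show ?thesis
        by (rule weighted_density_near_value[OF _ S r]) (use int r that in auto)
    qed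
    have supp: "supported_in (\<xi> - r) (\<xi> + r) (\<lambda>x. \<phi> x - \<theta> x)"
      using \<phi>(1) \<theta>(1) r by (auto simp: supported_in_def intro: continuous_on_diff)
    have i: "integrable lebesgue \<phi>" "integrable lebesgue \<theta>"
      "integrable lebesgue (\<lambda>x. \<phi> x * h x)" "integrable lebesgue (\<lambda>x. \<theta> x * h x)"
      using supported_in_integrable \<phi>(1) \<theta>(1) int r by (auto intro: less_imp_le)
    have "(LINT x|lebesgue. \<bar>\<phi> x - \<theta> x\<bar>) \<le> (LINT x|lebesgue. \<phi> x + \<theta> x)"
    proof (intro integral_mono integrable_abs)
      show "integrable lebesgue (\<lambda>x. \<phi> x - \<theta> x)" "integrable lebesgue (\<lambda>x. \<phi> x + \<theta> x)"
        using i by auto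
      show "\<bar>\<phi> x - \<theta> x\<bar> \<le> \<phi> x + \<theta> x" for x
        using \<phi>(2)[of x] \<theta>(2)[of x] by linarith
    qed
    also have "\<dots> = 2"
      using i \<phi>(3) \<theta>(3) by simp
    finally have le2: "(LINT x|lebesgue. \<bar>\<phi> x - \<theta> x\<bar>) \<le> 2" .
    have "\<bar>LINT x|lebesgue. (\<phi> x - \<theta> x) * h x\<bar> \<le>
        (\<xi> + r - (\<xi> - r)) * \<bar>C\<bar> * (LINT x|lebesgue. \<bar>\<phi> x - \<theta> x\<bar>)"
      using i \<phi>(3) \<theta>(3) r by (intro weak_derivative_bound(2)[OF h w(1) w' supp]) auto
    also have "\<dots> \<le> (\<xi> + r - (\<xi> - r)) * \<bar>C\<bar> * 2"
      using le2 r by (intro mult_left_mono) auto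
    finally have "\<bar>(LINT x|lebesgue. \<phi> x * h x) - (LINT x|lebesgue. \<theta> x * h x)\<bar> \<le> r * (4 * \<bar>C\<bar>)"
      using i by (simp add: left_diff_distrib)
    then have "\<bar>p - q\<bar> \<le> r * 4 + r * (4 * \<bar>C\<bar>)"
      using \<phi>(4) \<theta>(4) by linarith
    then show ?thesis by (simp add: distrib_left)
  qed
  have "((\<lambda>r. r * (4 + 4 * \<bar>C\<bar>)) \<longlongrightarrow> 0 * (4 + 4 * \<bar>C\<bar>)) (at_right 0)"
    by (intro tendsto_intros)
  then have "\<bar>p - q\<bar> \<le> 0 * (4 + 4 * \<bar>C\<bar>)"
    by (rule tendsto_lowerbound) (auto intro!: eventually_at_rightI[of 0 1] close)
  then show ?thesis by simp
qed

section \<open>Essential images and accumulation sets\<close>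

lemma vimage_sets_lebesgue:
  assumes "v \<in> borel_measurable lebesgue" "open N"
  shows "v -` N \<in> sets lebesgue"
  using measurable_sets[OF assms(1) borel_open[OF assms(2)]] by simp

lemma ess_im_mono:
  assumes "v \<in> borel_measurable lebesgue" "J \<in> sets lebesgue" "I \<subseteq> J"
  shows "ess_im v I \<subseteq> ess_im v J"
proof -
  have "emeasure lebesgue (v -` N \<inter> I) \<le> emeasure lebesgue (v -` N \<inter> J)" if "open N" for N
    using assms vimage_sets_lebesgue[OF assms(1) that] by (intro emeasure_mono) auto
  then show ?thesis
    unfolding ess_im_def by (blast intro: less_le_trans)
qed

text \<open>Compactness: otherwise every value has a neighbourhood that \<open>v\<close> meets only
  on a null subset of some \<open>J r\<close>. Finitely many of these neighbourhoods cover the ball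
  containing almost all values of \<open>v\<close>, so the \<open>J\<close> of the smallest radius
  would be null.\<close>

lemma INT_ess_im_nonempty:
  fixes v :: "real \<Rightarrow> real^'n" and J :: "real \<Rightarrow> real set"
  assumes v: "v \<in> borel_measurable lebesgue" and C: "AE x in lebesgue. norm (v x) \<le> C"
    and J: "\<And>r. 0 < r \<Longrightarrow> J r \<in> sets lebesgue" "\<And>r. 0 < r \<Longrightarrow> emeasure lebesgue (J r) > 0"
    and mono: "\<And>r s. 0 < r \<Longrightarrow> r \<le> s \<Longrightarrow> J r \<subseteq> J s"
  shows "(\<Inter>r\<in>{0<..}. ess_im v (J r)) \<noteq> {}"
proof
  assume "(\<Inter>r\<in>{0<..}. ess_im v (J r)) = {}"
  then have "\<exists>r>0. u \<notin> ess_im v (J r)" for u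
    by blast
  then have "\<forall>u. \<exists>N r. 0 < r \<and> open N \<and> u \<in> N \<and> emeasure lebesgue (v -` N \<inter> J r) = 0"
    unfolding ess_im_def by (simp add: zero_less_iff_neq_zero) blast
  then obtain N r where N: "\<And>u. 0 < r u" "\<And>u. open (N u)" "\<And>u. u \<in> N u"
    "\<And>u. emeasure lebesgue (v -` N u \<inter> J (r u)) = 0"
    by metis
  obtain D where D: "D \<subseteq> cball 0 C" "finite D" "cball 0 C \<subseteq> (\<Union>u\<in>D. N u)"
    by (rule compactE_image[OF compact_cball[of 0 C], of "cball 0 C" N]) (use N(2,3) in auto)
  \<comment> \<open>Inserting 1 keeps the minimum over a nonempty set even when \<open>D\<close> is
    empty, which can happen for negative \<open>C\<close>.\<close>
  define \<rho> where "\<rho> = Min (insert 1 (r ` D))"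
  have \<rho>: "0 < \<rho>" "\<And>u. u \<in> D \<Longrightarrow> \<rho> \<le> r u"
    using D(2) N(1) by (auto simp: \<rho>_def)
  have "AE x in lebesgue. x \<notin> v -` N u \<inter> J (r u)" for u
    using N J(1) vimage_sets_lebesgue[OF v] by (intro AE_not_in) (auto simp: null_sets_def)
  then have "AE x in lebesgue. \<forall>u\<in>D. x \<notin> v -` N u \<inter> J (r u)"
    using D(2) by (simp add: AE_finite_all)
  with C have "AE x in lebesgue. x \<notin> J \<rho>"
  proof eventually_elim
    case (elim x)
    then obtain u where "u \<in> D" "v x \<in> N u"
      using D(3) by (force simp: subset_iff)
    then show ?case
      using elim(2) mono[OF \<rho>(1) \<rho>(2)] by auto
  qed
  then have "emeasure lebesgue (J \<rho>) = 0"
    using AE_iff_null_sets[OF J(1)[OF \<rho>(1)]] by auto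
  then show False
    using J(2)[OF \<rho>(1)] by simp
qed

lemma acc_left_nonempty:
  assumes "L_infty v"
  shows "acc_left v \<xi> \<noteq> {}"
proof -
  obtain C where C: "AE x in lebesgue. norm (v x) \<le> C"
    using assms by (auto simp: L_infty_def)
  show ?thesis
    unfolding acc_left_def using assms
    by (intro INT_ess_im_nonempty[OF _ C]) (auto simp: L_infty_def)
qed

lemma acc_right_nonempty:
  assumes "L_infty v"
  shows "acc_right v \<xi> \<noteq> {}"
proof -
  obtain C where C: "AE x in lebesgue. norm (v x) \<le> C"
    using assms by (auto simp: L_infty_def)
  show ?thesis
    unfolding acc_right_def using assms
    by (intro INT_ess_im_nonempty[OF _ C]) (auto simp: L_infty_def)
qed

text \<open>Supplies the sets required by \<open>weak_derivative_no_jump\<close>, with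
  \<open>J\<close> the left or the right half-intervals. \<open>F\<close> has two arguments because
  the flux depends on \<open>x\<close> both directly and through \<open>v x\<close>.\<close>

lemma positive_measure_near_ess_im:
  fixes v :: "real \<Rightarrow> real^'n" and F :: "real \<Rightarrow> real^'n \<Rightarrow> real"
  assumes v: "v \<in> borel_measurable lebesgue"
    and u: "u \<in> (\<Inter>r\<in>{0<..}. ess_im v (J r))"
    and J: "\<And>r. J r \<in> sets lebesgue" "\<And>r. J r \<subseteq> ball \<xi> r" "\<And>r s. r \<le> s \<Longrightarrow> J r \<subseteq> J s"
    and F: "isCont (\<lambda>(x, y). F x y) (\<xi>, u)" and "0 < r" "0 < \<epsilon>"
  shows "\<exists>S\<in>sets lebesgue. S \<subseteq> J r \<and> emeasure lebesgue S > 0 \<and> (\<forall>x\<in>S. \<bar>F x (v x) - F \<xi> u\<bar> < \<epsilon>)"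
proof -
  have "\<forall>\<^sub>F z in nhds (\<xi>, u). dist ((\<lambda>(x, y). F x y) z) (F \<xi> u) < \<epsilon>"
    using F \<open>0 < \<epsilon>\<close> unfolding isCont_def tendsto_at_iff_tendsto_nhds
    by (auto dest: tendstoD)
  then obtain A B where AB: "eventually A (nhds \<xi>)" "eventually B (nhds u)"
    "\<And>x y. A x \<Longrightarrow> B y \<Longrightarrow> \<bar>F x y - F \<xi> u\<bar> < \<epsilon>"
    unfolding nhds_prod eventually_prod_filter by (auto simp: dist_real_def)
  obtain \<delta> where \<delta>: "\<delta> > 0" "\<And>x. dist x \<xi> < \<delta> \<Longrightarrow> A x"
    using AB(1) by (auto simp: eventually_nhds_metric)
  obtain N where N: "open N" "u \<in> N" "\<And>y. y \<in> N \<Longrightarrow> B y"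
    using AB(2) by (auto simp: eventually_nhds)
  \<comment> \<open>The bound \<open>r\<close> keeps the set inside \<open>J r\<close>, and
    \<open>\<delta>\<close> keeps \<open>x\<close> close enough to \<open>\<xi>\<close> for the
    first argument of \<open>F\<close>.\<close>
  let ?\<rho> = "min r \<delta>" let ?S = "v -` N \<inter> J ?\<rho>"
  have "emeasure lebesgue ?S > 0"
    using u N(1,2) \<open>0 < r\<close> \<delta>(1) by (auto simp: ess_im_def)
  moreover have "?S \<in> sets lebesgue"
    using J(1) vimage_sets_lebesgue[OF v N(1)] by auto
  moreover have "\<bar>F x (v x) - F \<xi> u\<bar> < \<epsilon>" if "x \<in> ?S" for x
  proof -
    have "x \<in> ball \<xi> ?\<rho>" using that J(2) by blast
    then show ?thesis using that \<delta> N AB(3) by (auto simp: dist_commute)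
  qed
  moreover have "?S \<subseteq> J r"
    using J(3)[of ?\<rho> r] by auto
  ultimately show ?thesis by blast
qed

section \<open>From the weak formulation to the Rankine-Hugoniot condition\<close>

text \<open>Reduction to scalars: the system is tested with \<open>\<psi>\<close> times the fixed
  vector \<open>e\<close>.\<close>

lemma flux_has_weak_derivative:
  fixes v :: "real \<Rightarrow> real^'n"
  assumes "self_similar_weak_solution U f v"
  shows "has_weak_derivative (\<lambda>x. e \<bullet> (- (x *\<^sub>R v x) + f (v x))) (\<lambda>x. - (e \<bullet> v x))"
  unfolding has_weak_derivative_def
proof (intro allI impI, elim conjE)
  fix \<psi> \<phi> :: "real \<Rightarrow> real" and a b :: real
  assume d: "\<forall>x. (\<psi> has_real_derivative \<phi> x) (at x)" and c: "continuous_on UNIV \<phi>"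
    and z: "\<forall>x. x \<notin> {a..b} \<longrightarrow> \<psi> x = 0"
  let ?\<Psi> = "\<lambda>x. \<psi> x *\<^sub>R e"
  have vd: "(?\<Psi> has_vector_derivative \<phi> x *\<^sub>R e) (at x)" for x
    using d by (auto intro!: derivative_eq_intros simp: has_real_derivative_iff_has_vector_derivative)
  have "{x. ?\<Psi> x \<noteq> 0} \<subseteq> {a..b}"
    using z by auto
  then have "compact (closure {x. ?\<Psi> x \<noteq> 0})"
    by (meson bounded_closed_interval bounded_subset compact_closure)
  moreover have "?\<Psi> C1_differentiable_on UNIV"
    unfolding C1_differentiable_on_def
    using vd c by (auto intro!: exI[of _ "\<lambda>x. \<phi> x *\<^sub>R e"] continuous_intros)
  ultimately have "C1_compact_support ?\<Psi>"
    by (simp add: C1_compact_support_def)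
  then have "has_bochner_integral lebesgue
      (\<lambda>\<xi>. vector_derivative ?\<Psi> (at \<xi>) \<bullet> (- (\<xi> *\<^sub>R v \<xi>) + f (v \<xi>)) - ?\<Psi> \<xi> \<bullet> v \<xi>) 0"
    using assms unfolding self_similar_weak_solution_def by blast
  then show "has_bochner_integral lebesgue
      (\<lambda>x. \<phi> x * (e \<bullet> (- (x *\<^sub>R v x) + f (v x))) + \<psi> x * - (e \<bullet> v x)) 0"
    by (simp add: vector_derivative_at[OF vd])
qed

text \<open>For every \<open>e\<close>, the component of the flux along \<open>e\<close> has the
  essentially bounded weak derivative \<open>- (e \<bullet> v x)\<close>, so its one-sided values at
  \<open>\<xi>\<close> agree; the components determine the vector.\<close>

lemma rankine_hugoniot:
  fixes v :: "real \<Rightarrow> real^'n"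
  assumes sol: "self_similar_weak_solution U f v"
    and um: "um \<in> acc_left v \<xi>" "isCont f um" and up: "up \<in> acc_right v \<xi>" "isCont f up"
  shows "- (\<xi> *\<^sub>R um) + f um = - (\<xi> *\<^sub>R up) + f up"
proof -
  obtain C where v: "v \<in> borel_measurable lebesgue" and C: "AE x in lebesgue. norm (v x) \<le> C"
    using sol by (auto simp: self_similar_weak_solution_def L_infty_def)
  have "e \<bullet> (- (\<xi> *\<^sub>R um) + f um) = e \<bullet> (- (\<xi> *\<^sub>R up) + f up)" for e
  proof (rule weak_derivative_no_jump[OF flux_has_weak_derivative[OF sol]])
    show "(\<lambda>x. - (e \<bullet> v x)) \<in> borel_measurable lebesgue"
      using v by measurable
    show "AE x in lebesgue. \<bar>- (e \<bullet> v x)\<bar> \<le> norm e * C"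
      using C
    proof eventually_elim
      case (elim x)
      then show ?case
        using Cauchy_Schwarz_ineq2[of e "v x"] mult_left_mono[of "norm (v x)" C "norm e"] by simp
    qed
    have cont: "isCont (\<lambda>(x, y). e \<bullet> (- (x *\<^sub>R y) + f y)) (\<xi>, u)" if "isCont f u" for u
    proof -
      have "isCont (\<lambda>z. f (snd z)) (\<xi>, u)"
        by (rule isCont_o2[OF isCont_snd[OF continuous_ident]]) (use that in simp)
      then show ?thesis
        unfolding case_prod_beta by (intro continuous_intros)
    qed
    fix r \<epsilon> :: real assume *: "0 < r" "0 < \<epsilon>"
    show "\<exists>S\<in>sets lebesgue. S \<subseteq> {\<xi> - r<..<\<xi>} \<and> emeasure lebesgue S > 0 \<and>
       (\<forall>x\<in>S. \<bar>e \<bullet> (- (x *\<^sub>R v x) + f (v x)) - e \<bullet> (- (\<xi> *\<^sub>R um) + f um)\<bar> < \<epsilon>)"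
      by (rule positive_measure_near_ess_im[OF v um(1)[unfolded acc_left_def] _ _ _ cont[OF um(2)] *])
         (auto simp: dist_real_def)
    show "\<exists>S\<in>sets lebesgue. S \<subseteq> {\<xi><..<\<xi> + r} \<and> emeasure lebesgue S > 0 \<and>
       (\<forall>x\<in>S. \<bar>e \<bullet> (- (x *\<^sub>R v x) + f (v x)) - e \<bullet> (- (\<xi> *\<^sub>R up) + f up)\<bar> < \<epsilon>)"
      by (rule positive_measure_near_ess_im[OF v up(1)[unfolded acc_right_def] _ _ _ cont[OF up(2)] *])
         (auto simp: dist_real_def)
  qed
  then show ?thesis
    using vector_eq_ldot by blast
qed

lemma acc_subset_ess_im:
  assumes "v \<in> borel_measurable lebesgue"
  shows "acc_left v \<xi> \<subseteq> ess_im v UNIV" "acc_right v \<xi> \<subseteq> ess_im v UNIV"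
proof -
  have mono: "ess_im v I \<subseteq> ess_im v UNIV" for I
    using assms by (intro ess_im_mono) auto
  have "acc_left v \<xi> \<subseteq> ess_im v {\<xi> - 1<..<\<xi>}" "acc_right v \<xi> \<subseteq> ess_im v {\<xi><..<\<xi> + 1}"
    by (auto simp: acc_left_def acc_right_def)
  then show "acc_left v \<xi> \<subseteq> ess_im v UNIV" "acc_right v \<xi> \<subseteq> ess_im v UNIV"
    using mono by blast+
qed

section \<open>The averaged Jacobian\<close>

text \<open>By the chain rule, the Jacobian applied to \<open>up - um\<close> is the derivative of
  \<open>f\<close> along the segment, and multiplication by a fixed vector, being linear, commutes
  with the integral.\<close>

lemma A_bar_mult_vector:
  fixes f :: "real^'n \<Rightarrow> real^'n" and f' :: "real^'n \<Rightarrow> (real^'n) \<Rightarrow>\<^sub>L (real^'n)"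
  assumes seg: "closed_segment um up \<subseteq> U" and cont: "continuous_on U f'"
    and deriv: "\<And>x. x \<in> U \<Longrightarrow> (f has_derivative blinfun_apply (f' x)) (at x)"
  shows "A_bar f um up *v (up - um) = f up - f um"
proof -
  let ?\<gamma> = "\<lambda>\<tau>::real. (1 - \<tau>) *\<^sub>R um + \<tau> *\<^sub>R up"
  let ?A = "\<lambda>\<tau>. jacobian f (at (?\<gamma> \<tau>))"
  have \<gamma>: "?\<gamma> \<tau> \<in> U" if "\<tau> \<in> {0..1}" for \<tau>
    using seg that by (auto simp: closed_segment_def)
  have A: "?A \<tau> = matrix (blinfun_apply (f' (?\<gamma> \<tau>)))" if "\<tau> \<in> {0..1}" for \<tau>
    using frechet_derivative_at[OF deriv[OF \<gamma>[OF that]]] by (simp add: jacobian_def)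
  have "continuous_on {0..1} (\<lambda>\<tau>. f' (?\<gamma> \<tau>))"
    by (rule continuous_on_compose2[OF cont]) (auto intro!: continuous_intros \<gamma>)
  then have "continuous_on {0..1} (\<lambda>\<tau>. matrix (blinfun_apply (f' (?\<gamma> \<tau>))))"
    unfolding matrix_def by (intro continuous_intros)
  then have "continuous_on {0..1} ?A"
    by (rule continuous_on_eq) (simp add: A)
  \<comment> \<open>Without integrability, \<open>integral\<close> in \<open>A_bar\<close> would
    only be a default value.\<close>
  then have int: "?A integrable_on {0..1}"
    by (rule integrable_continuous_real)
  have "linear (\<lambda>B::real^'n^'n. B *v (up - um))"
    by (intro linearI) (auto simp: matrix_vector_mult_add_rdistrib scaleR_matrix_vector_assoc)
  then have "((\<lambda>B. B *v (up - um)) \<circ> ?A has_integral A_bar f um up *v (up - um)) {0..1}"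
    unfolding A_bar_def
    by (intro has_integral_linear integrable_integral int) (simp add: linear_conv_bounded_linear)
  moreover have "((\<lambda>B. B *v (up - um)) \<circ> ?A has_integral f (?\<gamma> 1) - f (?\<gamma> 0)) {0..1}"
  proof (rule fundamental_theorem_of_calculus)
    fix \<tau> :: real assume \<tau>: "\<tau> \<in> {0..1}"
    have "f differentiable at (?\<gamma> \<tau>)"
      using deriv[OF \<gamma>[OF \<tau>]] by (rule differentiableI)
    then have "(f has_derivative (\<lambda>h. ?A \<tau> *v h)) (at (?\<gamma> \<tau>))"
      by (simp add: jacobian_works)
    then have "(f has_derivative (\<lambda>h. ?A \<tau> *v h)) (at (?\<gamma> \<tau>) within ?\<gamma> ` {0..1})"
      by (rule has_derivative_at_withinI)
    moreover have "(?\<gamma> has_vector_derivative up - um) (at \<tau> within {0..1})"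
      by (auto intro!: derivative_eq_intros simp: algebra_simps)
    ultimately show "((\<lambda>\<tau>. f (?\<gamma> \<tau>)) has_vector_derivative
        ((\<lambda>B. B *v (up - um)) \<circ> ?A) \<tau>) (at \<tau> within {0..1})"
      using vector_derivative_diff_chain_within[of ?\<gamma> "up - um" \<tau> "{0..1}" f] by (simp add: o_def)
  qed simp
  ultimately have "A_bar f um up *v (up - um) = f (?\<gamma> 1) - f (?\<gamma> 0)"
    by (rule has_integral_unique)
  then show ?thesis by simp
qed

lemma M_mat_mult_vector: "M_mat f um \<xi> up *v d = - (\<xi> *\<^sub>R d) + A_bar f um up *v d"
proof -
  have "M_mat f um \<xi> up = (- \<xi>) *\<^sub>R mat 1 + A_bar f um up"
    by (simp add: M_mat_def)
  then have "M_mat f um \<xi> up *v d = (- \<xi>) *\<^sub>R d + A_bar f um up *v d"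
    by (simp only: matrix_vector_mult_add_rdistrib scaleR_matrix_vector_assoc[symmetric]
        matrix_vector_mul_lid)
  then show ?thesis by simp
qed

section \<open>Existence of a jump and its singular matrix\<close>

theorem lemma7p3:
  fixes U :: "(real^'n) set"
    and f :: "real^'n \<Rightarrow> real^'n"
    and v :: "real \<Rightarrow> real^'n"
    and \<xi>s :: real
  assumes "open U"
    and "C2_on U f"
    and "convex hull (U_SH U f) \<subseteq> U"
    and "self_similar_weak_solution U f v"
    and "ess_im_discontinuity_point v \<xi>s"
  shows "\<exists>um \<in> acc_left v \<xi>s. \<exists>up \<in> acc_right v \<xi>s.
           up \<noteq> um \<and> RH_jump U f um \<xi>s up \<and> det (M_mat f um \<xi>s up) = 0"
proof -
  obtain f' :: "real^'n \<Rightarrow> (real^'n) \<Rightarrow>\<^sub>L (real^'n)" and f''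
    where f': "\<And>x. x \<in> U \<Longrightarrow> (f has_derivative blinfun_apply (f' x)) (at x)"
    and f'': "\<And>x. x \<in> U \<Longrightarrow> (f' has_derivative blinfun_apply (f'' x)) (at x)"
    using \<open>C2_on U f\<close> unfolding C2_on_def by blast
  have cont: "continuous_on U f'"
    using f'' by (meson continuous_at_imp_continuous_on has_derivative_continuous)
  have v: "L_infty v" "v \<in> borel_measurable lebesgue" and ess: "ess_im v UNIV \<subseteq> U_SH U f"
    using assms(4) by (auto simp: self_similar_weak_solution_def L_infty_def)
  obtain um up where um: "um \<in> acc_left v \<xi>s" and up: "up \<in> acc_right v \<xi>s" and "up \<noteq> um"
  \<comment> \<open>If every left value equals every right value, the two nonempty accumulation sets
    are the same singleton, which is continuity.\<close>
  proof (rule ccontr)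
    assume "\<not> thesis"
    then have same: "\<And>x y. x \<in> acc_left v \<xi>s \<Longrightarrow> y \<in> acc_right v \<xi>s \<Longrightarrow> y = x"
      using that by blast
    obtain x y where xy: "x \<in> acc_left v \<xi>s" "y \<in> acc_right v \<xi>s"
      using acc_left_nonempty[OF v(1)] acc_right_nonempty[OF v(1)] by blast
    have "acc_left v \<xi>s = {y}"
      using same[OF _ xy(2)] xy(1) by blast
    moreover have "acc_right v \<xi>s = {x}"
      using same[OF xy(1)] xy(2) by blast
    ultimately show False
      using assms(5) same[OF xy] unfolding ess_im_continuity_point_def by blast
  qed
  have SH: "um \<in> U_SH U f" "up \<in> U_SH U f"
    using acc_subset_ess_im[OF v(2)] um up ess by blast+
  then have in_U: "um \<in> U" "up \<in> U"
    by (auto simp: U_SH_def)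
  have "- (\<xi>s *\<^sub>R um) + f um = - (\<xi>s *\<^sub>R up) + f up"
    by (intro rankine_hugoniot[OF assms(4) um _ up] has_derivative_continuous[OF f'] in_U)
  then have RH: "- (\<xi>s *\<^sub>R (up - um)) + f up - f um = 0"
    by (simp add: algebra_simps)
  \<comment> \<open>The segment lies in the convex hull of the strictly hyperbolic states, hence
    where \<open>f\<close> is differentiable.\<close>
  have "closed_segment um up \<subseteq> U"
    using closed_segment_subset[OF hull_inc[OF SH(1)] hull_inc[OF SH(2)] convex_convex_hull] assms(3)
    by blast
  then have "A_bar f um up *v (up - um) = f up - f um"
    using f' cont by (intro A_bar_mult_vector) auto
  then have "M_mat f um \<xi>s up *v (up - um) = 0"
    using RH by (simp only: M_mat_mult_vector add_diff_eq)
  \<comment> \<open>A nonzero kernel vector rules out a left inverse.\<close>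
  then have "det (M_mat f um \<xi>s up) = 0"
    using \<open>up \<noteq> um\<close> invertible_det_nz[of "M_mat f um \<xi>s up"]
      matrix_left_invertible_ker[of "M_mat f um \<xi>s up"]
    by (auto simp: invertible_def)
  then show ?thesis
    using um up \<open>up \<noteq> um\<close> RH in_U unfolding RH_jump_def by blast
qed

end
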